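(* Let $f,g\in\mathbb{C}(z)$ be non-constant rational functions such that $f\circ g\in\mathbb{R}(z)$. Assume that $g$ is weakly injective on $\mathbb{R}$, and that the curve $\Gamma=g(\hat{\mathbb{R}})$ is not contained in a circle. Then the map $g\circ f:\Gamma\to\Gamma$ is not injective.
   Context: $\hat{\mathbb{C}}=\mathbb{C}\cup\{\infty\}$ is the Riemann sphere and $\hat{\mathbb{R}}=\mathbb{R}\cup\{\infty\}\subset\hat{\mathbb{C}}$. Rational functions are regarded as maps $\hat{\mathbb{C}}\to\hat{\mathbb{C}}$. Since $f\circ g\in\mathbb{R}(z)$, the map $f$ sends $\Gamma=g(\hat{\mathbb{R}})$ into $\hat{\mathbb{R}}$, so $g\circ f$ maps $\Gamma$ into $\Gamma$. A circle in $\hat{\mathbb{C}}$ is either a usual circle in $\mathbb{C}$ or a line in $\hat{\mathbb{C}}$ (including $\infty$); equivalently, a set $\lambda(\hat{\mathbb{R}})$ where $\lambda(z)=\frac{az+b}{cz+d}\in\mathbb{C}(z)$ with $ad-bc\neq0$. A rational function $g\in\mathbb{C}(z)$ is called weakly injective on $\mathbb{R}$ if there exists $z_0\in\mathbb{R}$ which is not a critical point of $g$ (i.e. $g:\hat{\mathbb{C}}\to\hat{\mathbb{C}}$ is unramified, that is locally injective, at $z_0$) and such that there is no $y_0\in\hat{\mathbb{R}}$ with $y_0\neq z_0$ and $g(y_0)=g(z_0)$. *)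

theory Defs
  imports "HOL-Analysis.Analysis" "HOL-Computational_Algebra.Polynomial"
begin

text \<open>The Riemann sphere is the one-point compactification of the plane; \<^term>\<open>None\<close> is the
  point at infinity.\<close>

type_synonym riemann_sphere = "complex option"

abbreviation sphere_topology :: "riemann_sphere topology" where
  "sphere_topology \<equiv> Alexandroff_compactification euclidean"

definition extended_reals :: "riemann_sphere set" where
  "extended_reals = insert None (Some ` (\<real> :: complex set))"

text \<open>The map of the sphere induced by the fraction \<open>p / q\<close> in lowest terms. If \<open>degree p \<le> degree q\<close>,
  the value at infinity is the quotient of the coefficients of index \<open>degree q\<close> (it is \<open>0\<close> when
  \<open>degree p < degree q\<close>). At a finite zero of \<open>q\<close> the value is infinity only because \<open>p\<close> and \<open>q\<close> are
  coprime, so this is to be used for coprime \<open>p\<close>, \<open>q\<close> with \<open>q \<noteq> 0\<close>.\<close>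

definition fraction_map :: "complex poly \<Rightarrow> complex poly \<Rightarrow> riemann_sphere \<Rightarrow> riemann_sphere" where
  "fraction_map p q x =
     (case x of
        Some z \<Rightarrow> if poly q z = 0 then None else Some (poly p z / poly q z)
      | None \<Rightarrow> if degree p > degree q then None
                else Some (coeff p (degree q) / lead_coeff q))"

text \<open>Rational functions with coefficients in a subfield \<open>K\<close> of the complex numbers, regarded as
  self-maps of the sphere: \<open>K = UNIV\<close> gives the complex and \<open>K = \<real>\<close> the real rational functions.\<close>

definition rational_functions :: "complex set \<Rightarrow> (riemann_sphere \<Rightarrow> riemann_sphere) set" where
  "rational_functions K =
     {fraction_map p q | p q. q \<noteq> 0 \<and> coprime p q \<and> (\<forall>i. coeff p i \<in> K \<and> coeff q i \<in> K)}"

definition critical_point :: "(riemann_sphere \<Rightarrow> riemann_sphere) \<Rightarrow> riemann_sphere \<Rightarrow> bool" where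
  "critical_point g x \<longleftrightarrow> \<not> (\<exists>U. openin sphere_topology U \<and> x \<in> U \<and> inj_on g U)"

definition weakly_injective :: "(riemann_sphere \<Rightarrow> riemann_sphere) \<Rightarrow> bool" where
  "weakly_injective g \<longleftrightarrow>
     (\<exists>z\<^sub>0 \<in> (\<real> :: complex set). \<not> critical_point g (Some z\<^sub>0) \<and>
        \<not> (\<exists>y\<^sub>0 \<in> extended_reals. y\<^sub>0 \<noteq> Some z\<^sub>0 \<and> g y\<^sub>0 = g (Some z\<^sub>0)))"

definition is_circle :: "riemann_sphere set \<Rightarrow> bool" where
  "is_circle C \<longleftrightarrow>
     (\<exists>c r. r > 0 \<and> C = Some ` sphere c r) \<or>
     (\<exists>a b. b \<noteq> 0 \<and> C = insert None (Some ` range (\<lambda>t::real. a + of_real t * b)))"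

lemma real_rational_function_extended_reals:
  assumes "h \<in> rational_functions \<real>" "x \<in> extended_reals"
  shows "h x \<in> extended_reals"
proof -
  obtain p q where h: "h = fraction_map p q" "\<forall>i. coeff p i \<in> \<real> \<and> coeff q i \<in> \<real>"
    using assms(1) by (auto simp: rational_functions_def)
  have "poly r z \<in> \<real>" if "\<forall>i. coeff r i \<in> \<real>" "z \<in> \<real>" for r and z :: complex
    using that by (auto simp: poly_altdef intro!: sum_in_Reals Reals_mult Reals_power)
  hence "poly p z / poly q z \<in> \<real>" if "z \<in> \<real>" for z
    using that h(2) by (simp add: Reals_divide)
  moreover have "coeff p (degree q) / lead_coeff q \<in> \<real>"
    using h(2) by (simp add: Reals_divide)
  ultimately show ?thesis
    using assms(2) by (cases x) (simp_all add: h(1) extended_reals_def fraction_map_def image_iff)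
qed

text \<open>Hence \<open>g \<circ> f\<close> is a self-map of the curve \<open>g ` extended_reals\<close>.\<close>

lemma comp_maps_curve:
  assumes "f \<circ> g \<in> rational_functions \<real>"
  shows "(g \<circ> f) ` (g ` extended_reals) \<subseteq> g ` extended_reals"
  using real_rational_function_extended_reals[OF assms] by auto

end

theory Submission
  imports Defs "HOL-Complex_Analysis.Conformal_Mappings"
    "HOL-Computational_Algebra.Fundamental_Theorem_Algebra"
begin

text \<open>Put \<open>h = f \<circ> g\<close>, which commutes with complex conjugation \<open>c\<close>. If \<open>g \<circ> f\<close> is injective on
  \<open>\<Gamma>\<close>, then so is \<open>f\<close>, and hence \<open>h\<close> identifies two real points only if \<open>g\<close> does. By weak
  injectivity and compactness of the extended real line, every real \<open>x\<close> close to the given point is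
  then the only real point of its fibre under \<open>h\<close> (\<open>single_real_fibres\<close>).

  The heart of the proof is that for such an \<open>x\<close>, with \<open>h x\<close> outside a finite set, \<open>g z = g x\<close>
  implies \<open>g (c z) = g x\<close>. Let \<open>F\<close> be the fibre of \<open>h\<close> through \<open>x\<close>. Away from finitely many
  values, \<open>h\<close> is a covering map (\<open>covering_space_plane_map\<close>), so a path from \<open>x\<close> to \<open>z\<close>
  projects to a loop whose monodromy \<open>u\<close> permutes \<open>F\<close> and sends \<open>x\<close> to \<open>z\<close>. As \<open>f\<close> is a
  covering too, monodromy respects the partition of \<open>F\<close> into fibres of \<open>g\<close>; this applies to \<open>u\<close>
  and to \<open>c u c\<close>, the monodromy of the conjugate loop. Now \<open>c\<close> and \<open>u c u\<inverse>\<close> are involutions of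
  \<open>F\<close>, the first fixing only \<open>x\<close> and the second fixing only \<open>z\<close>. In the dihedral group that they
  generate, \<open>c\<close> fixes exactly one point of the orbit of \<open>x\<close> under the rotation
  \<open>d = c u c u\<inverse>\<close>, so this orbit has odd length and the other reflection fixes a point of it as
  well. Hence \<open>z = d\<^sup>j x\<close> for some \<open>j\<close>, and \<open>c z = d\<^sup>-\<^sup>j x\<close>. Since \<open>d\<close> respects the fibres
  of \<open>g\<close>, applying \<open>d\<^sup>-\<^sup>j\<close> to \<open>g (d\<^sup>j x) = g x\<close> gives \<open>g x = g (c z)\<close>
  (\<open>dihedral_blocks\<close>, \<open>conjugate_blocks\<close>).

  Write \<open>g = a / b\<close>, and \<open>a*\<close>, \<open>b*\<close> for the polynomials with conjugate coefficients. What was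
  shown says that the polynomial \<open>b(x) a - a(x) b\<close>, whose zeros are simple, has its zeros
  among those of \<open>b*(x) a* - a*(x) b*\<close>, so that the second is a multiple of the first
  (\<open>conjugate_pencil\<close>). Two choices of \<open>x\<close> with distinct values of \<open>g\<close> express \<open>a*\<close> and \<open>b*\<close> as
  linear combinations of \<open>a\<close> and \<open>b\<close> (\<open>conjugate_is_Moebius\<close>). On \<open>\<Gamma>\<close> the conjugate of \<open>w\<close> is
  therefore a fixed linear fractional expression in \<open>w\<close>, and this puts \<open>\<Gamma>\<close> on a circle.\<close>

section \<open>Fibres of rational functions\<close>

definition plane_map :: "complex poly \<Rightarrow> complex poly \<Rightarrow> complex \<Rightarrow> complex" where
  "plane_map p q z = poly p z / poly q z"

definition plane_preimage :: "complex poly \<Rightarrow> complex poly \<Rightarrow> complex set \<Rightarrow> complex set" where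
  "plane_preimage p q T = {z. poly q z \<noteq> 0 \<and> plane_map p q z \<in> T}"

text \<open>The values \<open>t\<close> whose fibre is as large as possible: the equation \<open>p = t q\<close> has no solution at
  infinity and no multiple solution in the plane.\<close>

definition regular_value :: "complex poly \<Rightarrow> complex poly \<Rightarrow> complex \<Rightarrow> bool" where
  "regular_value p q t \<longleftrightarrow>
     degree (p - smult t q) = max (degree p) (degree q) \<and> rsquarefree (p - smult t q)"

lemma card_roots_rsquarefree:
  assumes "rsquarefree (r :: complex poly)"
  shows "card {z. poly r z = 0} = degree r"
proof -
  have "r \<noteq> 0" using assms by (auto simp: rsquarefree_def)
  have "degree r = degree (\<Prod>z|poly r z = 0. [:-z, 1:])"
    using complex_poly_decompose_rsquarefree[OF assms] \<open>r \<noteq> 0\<close>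
    by (metis degree_smult_eq leading_coeff_0_iff)
  also have "\<dots> = card {z. poly r z = 0}"
    by (subst degree_prod_sum_eq) auto
  finally show ?thesis by simp
qed

text \<open>At a root of \<open>p\<close> of order \<open>m\<close>, which is not a root of \<open>q\<close>, the product \<open>p' q\<close> vanishes to
  order \<open>m - 1\<close> but \<open>p q'\<close> at least to order \<open>m\<close>. If \<open>p\<close> is constant, exchange \<open>p\<close> and \<open>q\<close>.\<close>

lemma wronskian_nonzero:
  fixes p q :: "complex poly"
  assumes "coprime p q" "0 < max (degree p) (degree q)"
  shows "pderiv p * q - p * pderiv q \<noteq> 0"
proof -
  have claim: "pderiv r * s \<noteq> r * pderiv s" if rs: "coprime r s" "degree r > 0" for r s :: "complex poly"
  proof
    assume eq: "pderiv r * s = r * pderiv s"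
    obtain z where z: "poly r z = 0"
      using rs(2) fundamental_theorem_of_algebra_alt[of r] by fastforce
    have sz: "poly s z \<noteq> 0" using coprime_poly_0[OF rs(1), of z] z by simp
    have nz: "r \<noteq> 0" "pderiv r \<noteq> 0" "s \<noteq> 0" using rs(2) sz by (auto simp: pderiv_eq_0_iff)
    then have "r * pderiv s \<noteq> 0" using eq by (metis no_zero_divisors)
    have "order z (pderiv r) = order z (pderiv r * s)"
      using nz sz by (simp add: order_mult order_0I)
    also have "\<dots> = order z r + order z (pderiv s)"
      unfolding eq by (rule order_mult) fact
    also have "order z r = Suc (order z (pderiv r))"
      by (rule order_pderiv) (use nz z in \<open>auto simp: order_root\<close>)
    finally show False by simp
  qed
  show ?thesis
    using assms claim[of p q] claim[of q p] by (auto simp: coprime_commute max_def mult.commute split: if_splits)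
qed

lemma finite_irregular_values:
  assumes cop: "coprime p q" and pos: "0 < max (degree p) (degree q)"
  shows "finite {t. \<not> regular_value p q t}"
proof -
  define N where "N = max (degree p) (degree q)"
  define W where "W = pderiv p * q - p * pderiv q"
  have "W \<noteq> 0" unfolding W_def by (rule wronskian_nonzero[OF cop pos])
  \<comment> \<open>Either a root of \<open>p - t q\<close> escapes to infinity, and \<open>t\<close> is the ratio of the top
    coefficients, or \<open>p - t q\<close> has a double root, and there the Wronskian vanishes.\<close>
  have "{t. \<not> regular_value p q t} \<subseteq> insert (coeff p N / coeff q N) (plane_map p q ` {z. poly W z = 0})"
  proof
    fix t assume "t \<in> {t. \<not> regular_value p q t}"
    then consider "degree (p - smult t q) \<noteq> N" | "\<not> rsquarefree (p - smult t q)"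
      by (auto simp: regular_value_def N_def)
    then show "t \<in> insert (coeff p N / coeff q N) (plane_map p q ` {z. poly W z = 0})"
    proof cases
      case 1
      have "degree (p - smult t q) \<le> N"
        unfolding N_def by (meson degree_diff_le_max degree_smult_le le_max_iff_disj max.mono order.refl order_trans)
      then have "coeff (p - smult t q) N = 0"
        using 1 by (intro coeff_eq_0) simp
      moreover have "coeff p N \<noteq> 0 \<or> coeff q N \<noteq> 0"
        using pos by (auto simp: N_def max_def)
      ultimately show ?thesis by (auto simp: field_simps)
    next
      case 2
      then obtain z where z: "poly p z = t * poly q z" "poly (pderiv p) z = t * poly (pderiv q) z"
        by (auto simp: rsquarefree_roots pderiv_diff pderiv_smult)
      have "poly q z \<noteq> 0" using z(1) coprime_poly_0[OF cop, of z] by auto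
      moreover have "poly W z = 0" using z by (simp add: W_def)
      ultimately show ?thesis using z(1) by (auto simp: plane_map_def image_iff intro!: exI[of _ z])
    qed
  qed
  then show ?thesis
    by (rule finite_subset) (use poly_roots_finite[OF \<open>W \<noteq> 0\<close>] in simp)
qed

lemma plane_map_eq_iff:
  assumes "coprime p q"
  shows "poly (p - smult t q) z = 0 \<longleftrightarrow> poly q z \<noteq> 0 \<and> plane_map p q z = t"
  using coprime_poly_0[OF assms, of z] by (auto simp: plane_map_def field_simps)

lemma regular_value_nonzero: "regular_value p q t \<Longrightarrow> p - smult t q \<noteq> 0"
  by (simp add: regular_value_def rsquarefree_def)

lemma regular_fibre:
  assumes "coprime p q" "regular_value p q t"
  shows "finite {z. poly q z \<noteq> 0 \<and> plane_map p q z = t}"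
    and "card {z. poly q z \<noteq> 0 \<and> plane_map p q z = t} = max (degree p) (degree q)"
  using assms poly_roots_finite[OF regular_value_nonzero[OF assms(2)]]
    card_roots_rsquarefree[of "p - smult t q"]
  unfolding plane_map_eq_iff[OF assms(1)] by (simp_all add: regular_value_def)

lemma finite_plane_fibre:
  assumes "coprime p q" "0 < max (degree p) (degree q)"
  shows "finite {z. poly q z \<noteq> 0 \<and> plane_map p q z = t}"
proof -
  have "p - smult t q \<noteq> 0"
  proof
    assume "p - smult t q = 0"
    then have "p = smult t q" by simp
    then have "q dvd p" by (metis dvd_refl dvd_smult)
    then have "is_unit q" using assms(1) by (metis coprime_common_divisor dvd_refl)
    then have "degree q = 0" by (auto simp: is_unit_poly_iff)
    moreover have "degree p \<le> degree q" using \<open>p = smult t q\<close> by (metis degree_smult_le)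
    ultimately show False using assms(2) by simp
  qed
  then have "finite {z. poly (p - smult t q) z = 0}" by (rule poly_roots_finite)
  then show ?thesis unfolding plane_map_eq_iff[OF assms(1)] .
qed

lemma fraction_map_Some_iff:
  "fraction_map p q (Some z) = Some t \<longleftrightarrow> poly q z \<noteq> 0 \<and> plane_map p q z = t"
  by (auto simp: fraction_map_def plane_map_def)

lemma regular_value_infinity:
  assumes "regular_value p q t" "q \<noteq> 0"
  shows "fraction_map p q None \<noteq> Some t"
proof
  assume "fraction_map p q None = Some t"
  then have "degree p \<le> degree q" "coeff (p - smult t q) (degree q) = 0"
    using assms(2) by (auto simp: fraction_map_def split: if_splits)
  then show False
    using assms(1) regular_value_nonzero[OF assms(1)]
    by (metis leading_coeff_0_iff max.absorb2 regular_value_def)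
qed

lemma finite_fibre_fraction_map:
  assumes "coprime p q" "q \<noteq> 0" "0 < max (degree p) (degree q)"
  shows "finite {x. fraction_map p q x = y}"
proof (cases y)
  case None
  have "{x. fraction_map p q x = y} \<subseteq> insert None (Some ` {z. poly q z = 0})"
  proof
    fix x assume "x \<in> {x. fraction_map p q x = y}"
    then show "x \<in> insert None (Some ` {z. poly q z = 0})"
      using None by (cases x) (auto simp: fraction_map_def split: if_splits)
  qed
  then show ?thesis
    by (rule finite_subset) (use poly_roots_finite[OF assms(2)] in simp)
next
  case (Some t)
  have "{x. fraction_map p q x = y} \<subseteq> insert None (Some ` {z. poly q z \<noteq> 0 \<and> plane_map p q z = t})"
  proof
    fix x assume "x \<in> {x. fraction_map p q x = y}"
    then show "x \<in> insert None (Some ` {z. poly q z \<noteq> 0 \<and> plane_map p q z = t})"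
      using Some fraction_map_Some_iff by (cases x) auto
  qed
  then show ?thesis
    by (rule finite_subset) (use finite_plane_fibre[OF assms(1,3)] in simp)
qed

lemma nonconstant_fraction_map:
  assumes "q \<noteq> 0" "\<not> fraction_map p q constant_on UNIV"
  shows "0 < max (degree p) (degree q)"
proof (rule ccontr)
  assume "\<not> ?thesis"
  then obtain c d where "p = [:c:]" "q = [:d:]" by (metis degree_0_id max_less_iff_conj neq0_conv less_max_iff_disj)
  then have "fraction_map p q x = Some (c / d)" for x
    using assms(1) by (cases x) (auto simp: fraction_map_def)
  then show False using assms(2) by (auto simp: constant_on_def)
qed

section \<open>Rational functions as covering maps\<close>

lemma plane_map_holomorphic: "plane_map p q holomorphic_on {z. poly q z \<noteq> 0}"
  unfolding plane_map_def by (intro holomorphic_intros) auto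

lemma open_nonroots: "open {z. poly q z \<noteq> (0 :: complex)}"
  by (intro open_Collect_neq continuous_intros)

text \<open>The numerator of the derivative of \<open>p / q\<close> at a solution of \<open>p = t q\<close> is \<open>q\<close> times the derivative
  of \<open>p - t q\<close>, which does not vanish at a simple root.\<close>

lemma deriv_plane_map_nonzero:
  assumes "coprime p q" "regular_value p q t" "poly q z \<noteq> 0" "plane_map p q z = t"
  shows "deriv (plane_map p q) z \<noteq> 0"
proof -
  have "poly (p - smult t q) z = 0" using assms plane_map_eq_iff by blast
  then have nz: "poly (pderiv p) z \<noteq> t * poly (pderiv q) z"
    using assms(2) unfolding regular_value_def rsquarefree_roots
    by (auto simp: pderiv_diff pderiv_smult)
  have "poly p z = t * poly q z" using assms by (auto simp: plane_map_def)
  have "(plane_map p q has_field_derivative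
      (poly (pderiv p) z * poly q z - poly p z * poly (pderiv q) z) / (poly q z * poly q z)) (at z)"
    unfolding plane_map_def using assms(3) by (auto intro!: derivative_eq_intros)
  then have "deriv (plane_map p q) z =
      (poly (pderiv p) z * poly q z - poly p z * poly (pderiv q) z) / (poly q z * poly q z)"
    by (rule DERIV_imp_deriv)
  also have "\<dots> = (poly (pderiv p) z - t * poly (pderiv q) z) / poly q z"
    using assms(3) \<open>poly p z = t * poly q z\<close> by (simp add: field_simps)
  finally show ?thesis using nz assms(3) by simp
qed

lemma finite_separated_balls:
  fixes R :: "'a::metric_space set"
  assumes "finite R"
  obtains e where "e > 0" "\<And>x y. x \<in> R \<Longrightarrow> y \<in> R \<Longrightarrow> x \<noteq> y \<Longrightarrow> ball x e \<inter> ball y e = {}"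
proof -
  define D where "D = insert 1 ((\<lambda>(x, y). dist x y) ` {(x, y) \<in> R \<times> R. x \<noteq> y})"
  have "finite {(x, y) \<in> R \<times> R. x \<noteq> y}"
    by (rule finite_subset[of _ "R \<times> R"]) (use assms in auto)
  then have D: "finite D" "D \<noteq> {}" unfolding D_def by simp_all
  have "Min D > 0" using D by (auto simp: D_def)
  show thesis
  proof
    show "Min D / 2 > 0" using \<open>Min D > 0\<close> by simp
    fix x y assume "x \<in> R" "y \<in> R" "x \<noteq> y"
    then have "Min D \<le> dist x y" using D(1) by (intro Min_le) (auto simp: D_def)
    then show "ball x (Min D / 2) \<inter> ball y (Min D / 2) = {}"
      by (intro disjoint_ballI) simp
  qed
qed

text \<open>Around each point of a regular fibre the map is a local homeomorphism. These sheets give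
  as many preimages of a nearby value as the degree allows, so they contain its whole fibre.\<close>

lemma covering_space_plane_map:
  assumes cop: "coprime p q" and pos: "0 < max (degree p) (degree q)" and "open T"
    and reg: "\<And>t. t \<in> T \<Longrightarrow> regular_value p q t"
  shows "covering_space (plane_preimage p q T) (plane_map p q) T"
proof
  let ?S = "plane_preimage p q T"
  let ?fib = "\<lambda>t. {z. poly q z \<noteq> 0 \<and> plane_map p q z = t}"
  have cont: "continuous_on {z. poly q z \<noteq> 0} (plane_map p q)"
    by (rule holomorphic_on_imp_continuous_on[OF plane_map_holomorphic])
  show "continuous_on ?S (plane_map p q)"
    using cont by (rule continuous_on_subset) (auto simp: plane_preimage_def)
  show "plane_map p q ` ?S = T"
  proof (intro equalityI subsetI)
    fix t assume "t \<in> T"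
    have "?fib t \<noteq> {}"
      using regular_fibre(2)[OF cop reg[OF \<open>t \<in> T\<close>]] pos by (metis card.empty less_irrefl)
    then show "t \<in> plane_map p q ` ?S" using \<open>t \<in> T\<close> by (auto simp: plane_preimage_def)
  qed (auto simp: plane_preimage_def)
  fix t assume "t \<in> T"
  define R where "R = ?fib t"
  have R: "finite R" "card R = max (degree p) (degree q)"
    unfolding R_def using regular_fibre[OF cop reg[OF \<open>t \<in> T\<close>]] by auto
  obtain e where e: "e > 0"
    and sep: "\<And>x y. x \<in> R \<Longrightarrow> y \<in> R \<Longrightarrow> x \<noteq> y \<Longrightarrow> ball x e \<inter> ball y e = {}"
    using finite_separated_balls[OF R(1)] by metis
  have "\<exists>r>0. ball z r \<subseteq> {z. poly q z \<noteq> 0} \<and> inj_on (plane_map p q) (ball z r)" if "z \<in> R" for z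
  proof -
    have "z \<in> {z. poly q z \<noteq> 0}" "deriv (plane_map p q) z \<noteq> 0"
      using that deriv_plane_map_nonzero[OF cop reg[OF \<open>t \<in> T\<close>]] by (auto simp: R_def)
    then show ?thesis
      by (metis has_complex_derivative_locally_injective[OF plane_map_holomorphic _ open_nonroots])
  qed
  then obtain r where r: "\<And>z. z \<in> R \<Longrightarrow> r z > 0"
      "\<And>z. z \<in> R \<Longrightarrow> ball z (r z) \<subseteq> {z. poly q z \<noteq> 0}"
      "\<And>z. z \<in> R \<Longrightarrow> inj_on (plane_map p q) (ball z (r z))"
    by metis
  define B where "B z = ball z (min (r z) e)" for z
  have B: "open (B z)" "z \<in> B z" "B z \<subseteq> {z. poly q z \<noteq> 0}" "inj_on (plane_map p q) (B z)" if "z \<in> R" for z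
    using r[OF that] e by (auto simp: B_def intro: inj_on_subset)
  have disj: "B x \<inter> B y = {}" if "x \<in> R" "y \<in> R" "x \<noteq> y" for x y
    using sep[OF that] by (auto simp: B_def)
  have open_image: "open (plane_map p q ` B z)" if "z \<in> R" for z
    using B[OF that] cont by (intro invariance_of_domain) (auto intro: continuous_on_subset)
  \<comment> \<open>Over \<open>V\<close> every sheet \<open>B z\<close> contains a preimage.\<close>
  define V where "V = T \<inter> (\<Inter>z\<in>R. plane_map p q ` B z)"
  have "open V" unfolding V_def using \<open>open T\<close> R(1) open_image by (intro open_Int open_INT) auto
  have "t \<in> V" unfolding V_def using \<open>t \<in> T\<close> B(2) by (force simp: R_def)
  define U where "U z = B z \<inter> plane_map p q -` V" for z
  have openU: "open (U z)" if "z \<in> R" for z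
    unfolding U_def using B[OF that] cont \<open>open V\<close>
    by (metis continuous_on_open_vimage continuous_on_subset Int_commute)
  have imU: "plane_map p q ` U z = V" if "z \<in> R" for z
  proof (intro equalityI subsetI)
    fix s assume "s \<in> V"
    then obtain w where "w \<in> B z" "s = plane_map p q w"
      using \<open>z \<in> R\<close> by (auto simp: V_def)
    then show "s \<in> plane_map p q ` U z" using \<open>s \<in> V\<close> by (auto simp: U_def)
  qed (auto simp: U_def)
  show "\<exists>Ta. t \<in> Ta \<and> openin (top_of_set T) Ta \<and>
      (\<exists>v. \<Union>v = ?S \<inter> plane_map p q -` Ta \<and> (\<forall>u\<in>v. openin (top_of_set ?S) u) \<and>
        pairwise disjnt v \<and> (\<forall>u\<in>v. \<exists>g. homeomorphism u Ta (plane_map p q) g))"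
  proof (rule exI[of _ V], intro conjI exI[of _ "U ` R"] ballI)
    show "t \<in> V" by fact
    show "openin (top_of_set T) V" using \<open>open V\<close> by (auto simp: V_def openin_open_eq[OF \<open>open T\<close>])
    show "\<Union>(U ` R) = ?S \<inter> plane_map p q -` V"
    proof (intro equalityI subsetI)
      fix w assume "w \<in> \<Union>(U ` R)"
      then show "w \<in> ?S \<inter> plane_map p q -` V"
        using B(3) by (auto simp: U_def V_def plane_preimage_def)
    next
      fix w assume w: "w \<in> ?S \<inter> plane_map p q -` V"
      define s where "s = plane_map p q w"
      have "s \<in> V" "w \<in> ?fib s" using w by (auto simp: s_def plane_preimage_def)
      then have "s \<in> T" by (simp add: V_def)
      have "\<exists>y. y \<in> U z \<and> plane_map p q y = s" if "z \<in> R" for z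
        using imU[OF that] \<open>s \<in> V\<close> by blast
      then obtain y where y: "\<And>z. z \<in> R \<Longrightarrow> y z \<in> U z \<and> plane_map p q (y z) = s"
        by metis
      \<comment> \<open>One preimage of \<open>s\<close> in each sheet already exhausts the fibre of \<open>s\<close>, by counting.\<close>
      have "inj_on y R"
        using disj y by (fastforce simp: inj_on_def U_def)
      then have "card (y ` R) = max (degree p) (degree q)"
        using R(2) by (simp add: card_image)
      moreover have "y ` R \<subseteq> ?fib s" using y B(3) by (auto simp: U_def)
      ultimately have "y ` R = ?fib s"
        using regular_fibre[OF cop reg[OF \<open>s \<in> T\<close>]] by (intro card_subset_eq) auto
      then show "w \<in> \<Union>(U ` R)" using \<open>w \<in> ?fib s\<close> y by (metis (no_types, lifting) UN_iff imageE)
    qed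
    show "openin (top_of_set ?S) u" if "u \<in> U ` R" for u
      using that openU B(3) by (intro open_openin_trans open_subset)
        (auto simp: U_def V_def plane_preimage_def)
    show "pairwise disjnt (U ` R)"
      using disj by (auto simp: pairwise_def disjnt_def U_def)
    show "\<exists>g. homeomorphism u V (plane_map p q) g" if "u \<in> U ` R" for u
    proof -
      obtain z where z: "z \<in> R" "u = U z" using \<open>u \<in> U ` R\<close> by blast
      have "continuous_on (U z) (plane_map p q)" "inj_on (plane_map p q) (U z)"
        using cont B[OF z(1)] by (auto simp: U_def intro: continuous_on_subset inj_on_subset)
      then show ?thesis
        using invariance_of_domain_homeomorphism[OF openU[OF z(1)]] imU[OF z(1)] z(2)
        by (metis le_refl)
    qed
  qed
qed

lemma path_connected_plane_preimage:
  assumes q: "q \<noteq> 0" and fibres: "\<And>t. t \<notin> T \<Longrightarrow> finite {z. poly q z \<noteq> 0 \<and> plane_map p q z = t}"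
    and "finite (- T)"
  shows "path_connected (plane_preimage p q T)"
proof -
  have eq: "plane_preimage p q T = UNIV - ({z. poly q z = 0} \<union> (\<Union>t\<in>-T. {z. poly q z \<noteq> 0 \<and> plane_map p q z = t}))"
    by (auto simp: plane_preimage_def)
  show ?thesis unfolding eq
    by (rule path_connected_open_diff_countable)
       (use assms poly_roots_finite[OF q] in \<open>auto intro!: countable_finite\<close>)
qed

section \<open>Monodromy and complex conjugation\<close>

text \<open>The fibres of \<open>\<kappa>\<close> are the blocks of a partition of \<open>F\<close> that \<open>u\<close> and \<open>c u c\<close> respect. The
  reflections \<open>c\<close> and \<open>u c u\<inverse>\<close> have one fixed point each, \<open>x0\<close> and \<open>u x0\<close>. The orbit of \<open>x0\<close>
  under the rotation \<open>d = c u c u\<inverse>\<close> is an odd cycle, since \<open>c\<close> fixes just one of its points; so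
  the second reflection fixes one of its points too, which must be \<open>u x0\<close>. If
  \<open>u x0 = d\<^sup>j x0\<close>, then \<open>d\<^sup>j\<close> maps the pair of \<open>x0\<close> and \<open>c (u x0)\<close> to the pair of \<open>u x0\<close> and
  \<open>x0\<close>, which lie in one block.\<close>

lemma dihedral_blocks:
  fixes c u :: "'a \<Rightarrow> 'a" and \<kappa> :: "'a \<Rightarrow> 'b"
  assumes fin: "finite F" and x0: "x0 \<in> F"
    and cF: "\<And>y. y \<in> F \<Longrightarrow> c y \<in> F" and cc: "\<And>y. y \<in> F \<Longrightarrow> c (c y) = y"
    and cfix: "\<And>y. y \<in> F \<Longrightarrow> c y = y \<longleftrightarrow> y = x0"
    and u: "bij_betw u F F"
    and \<kappa>u: "\<And>a b. a \<in> F \<Longrightarrow> b \<in> F \<Longrightarrow> \<kappa> (u a) = \<kappa> (u b) \<longleftrightarrow> \<kappa> a = \<kappa> b"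
    and \<kappa>cu: "\<And>a b. a \<in> F \<Longrightarrow> b \<in> F \<Longrightarrow> \<kappa> (c (u (c a))) = \<kappa> (c (u (c b))) \<longleftrightarrow> \<kappa> a = \<kappa> b"
    and block: "\<kappa> (u x0) = \<kappa> x0"
  shows "\<kappa> (c (u x0)) = \<kappa> x0"
proof -
  \<comment> \<open>With \<open>v\<close> the inverse of \<open>u\<close>, the second reflection is \<open>u c v\<close> and \<open>d = c u c v\<close>
    is the rotation; \<open>u c v = c d\<close> on \<open>F\<close>.\<close>
  define v where "v = the_inv_into F u"
  have v: "v y \<in> F" "u (v y) = y" "v (u y) = y" if "y \<in> F" for y
    using u that unfolding v_def
    by (auto simp: bij_betw_def the_inv_into_into f_the_inv_into_f the_inv_into_f_f)
  have uF: "u y \<in> F" if "y \<in> F" for y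
    using u that by (auto simp: bij_betw_def)
  define d where "d y = c (u (c (v y)))" for y
  have dF: "d y \<in> F" if "y \<in> F" for y
    using that by (simp add: d_def cF uF v)
  have dcd: "d (c (d y)) = c y" if "y \<in> F" for y
    using that by (simp add: d_def cF uF v cc)
  have d_inj: "a = b" if "a \<in> F" "b \<in> F" "d a = d b" for a b
    using that dcd cc by metis
  have \<kappa>d: "\<kappa> (d a) = \<kappa> (d b) \<longleftrightarrow> \<kappa> a = \<kappa> b" if "a \<in> F" "b \<in> F" for a b
    using that \<kappa>cu[of "v a" "v b"] \<kappa>u[of "v a" "v b"] by (simp add: d_def v)

  define D where "D n = d ^^ n" for n
  have DF: "D n y \<in> F" if "y \<in> F" for n y
    by (induction n) (use that in \<open>auto simp: D_def dF\<close>)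
  have D_inj: "a = b" if "a \<in> F" "b \<in> F" "D n a = D n b" for a b n
    using that(3)
  proof (induction n)
    case (Suc n)
    then show ?case using d_inj[OF DF DF] that by (auto simp: D_def)
  qed (simp add: D_def)
  have D_add: "D (m + n) y = D m (D n y)" for m n y
    by (simp add: D_def funpow_add)
  have \<kappa>D: "\<kappa> (D n a) = \<kappa> (D n b) \<longleftrightarrow> \<kappa> a = \<kappa> b" if "a \<in> F" "b \<in> F" for a b n
  proof (induction n)
    case (Suc n)
    then show ?case using \<kappa>d[OF DF DF, of a b n n] that by (simp add: D_def)
  qed (simp add: D_def)
  have DcD: "D n (c (D n y)) = c y" if "y \<in> F" for n y
  proof (induction n)
    case (Suc n)
    have "D (Suc n) (c (D (Suc n) y)) = D n (d (c (d (D n y))))"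
      by (simp add: D_def funpow_swap1)
    then show ?case using dcd[OF DF[OF that]] Suc by simp
  qed (simp add: D_def)

  have "\<exists>s>0. D s x0 = x0"
  proof -
    have "\<not> inj (\<lambda>n. D n x0)"
      using finite_imageD[of "\<lambda>n. D n x0" UNIV] finite_subset[OF _ fin] DF[OF x0]
      by (metis image_subsetI infinite_UNIV_nat)
    then obtain m n where mn: "m < n" "D m x0 = D n x0"
      by (metis injI linorder_neqE_nat)
    then have "D m (D (n - m) x0) = D m x0"
      using D_add[of m "n - m" x0] by simp
    then have "D (n - m) x0 = x0" using D_inj[OF DF x0] x0 by blast
    then show ?thesis using \<open>m < n\<close> by (intro exI[of _ "n - m"]) simp
  qed
  define s where "s = (LEAST s. s > 0 \<and> D s x0 = x0)"
  have s: "s > 0" "D s x0 = x0" and least: "\<And>j. 0 < j \<Longrightarrow> D j x0 = x0 \<Longrightarrow> s \<le> j"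
    using LeastI_ex[OF \<open>\<exists>s>0. D s x0 = x0\<close>] by (auto simp: s_def intro: Least_le)
  have c0: "c x0 = x0" using cfix x0 by blast
  \<comment> \<open>If the orbit of \<open>x0\<close> had even length, \<open>c\<close> would also fix the opposite point.\<close>
  have "odd s"
  proof
    assume "even s"
    then obtain j where j: "s = j + j" by (metis evenE mult_2)
    have "D j (c (D j x0)) = D j (D j x0)"
      using DcD[OF x0] c0 s(2) D_add[of j j] j by simp
    then have "c (D j x0) = D j x0" using D_inj[OF cF DF] DF x0 by metis
    then have "D j x0 = x0" using cfix DF x0 by blast
    then show False using least[of j] s(1) j by simp
  qed
  then obtain j where j: "s = Suc j + j" by (metis oddE mult_2 add_Suc Suc_eq_plus1)
  \<comment> \<open>The second reflection \<open>c \<circ> d\<close> fixes the point half way round the orbit.\<close>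
  have "D (Suc j) (c (D (Suc j) x0)) = D (Suc j) (D j x0)"
    using DcD[OF x0] c0 s(2) D_add[of "Suc j" j] j by simp
  then have "c (D (Suc j) x0) = D j x0" using D_inj[OF cF[OF DF[OF x0]] DF[OF x0]] by blast
  then have "c (d (D j x0)) = D j x0" by (simp add: D_def)
  then have "u (c (v (D j x0))) = D j x0" using DF[OF x0, of j] by (simp add: d_def cc cF uF v)
  then have "c (v (D j x0)) = v (D j x0)" using v cF DF[OF x0] by metis
  then have "v (D j x0) = x0" using cfix v DF[OF x0] by blast
  then have ux: "u x0 = D j x0" using v(2)[OF DF[OF x0]] by metis
  have "\<kappa> (D j (c (D j x0))) = \<kappa> (D j x0)"
    using DcD[OF x0, of j] c0 block ux by simp
  then show ?thesis using \<kappa>D[OF cF[OF DF[OF x0]] x0] ux by simp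
qed

text \<open>The monodromy relation: the lift of \<open>\<delta>\<close> that starts at \<open>y\<close> ends at \<open>y'\<close>. A relation
  needs no choice of lift, and reversing the path transposes it.\<close>

definition lifts_to ::
  "'a::real_normed_vector set \<Rightarrow> ('a \<Rightarrow> 'b) \<Rightarrow> (real \<Rightarrow> 'b) \<Rightarrow> 'a \<Rightarrow> 'a \<Rightarrow> bool" where
  "lifts_to C p \<delta> y y' \<longleftrightarrow>
     (\<exists>k. path k \<and> path_image k \<subseteq> C \<and> pathstart k = y \<and> pathfinish k = y' \<and>
        (\<forall>s\<in>{0..1}. p (k s) = \<delta> s))"

lemma lifts_to_exists:
  fixes \<delta> :: "real \<Rightarrow> 'b::real_normed_vector"
  assumes "covering_space C p S" "path \<delta>" "path_image \<delta> \<subseteq> S" "y \<in> C" "p y = pathstart \<delta>"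
  obtains y' where "lifts_to C p \<delta> y y'"
proof -
  obtain k where "path k" "path_image k \<subseteq> C" "pathstart k = y" "\<And>s. s \<in> {0..1} \<Longrightarrow> p (k s) = \<delta> s"
    using covering_space_lift_path_strong[OF assms(1,4,2,3) assms(5)[symmetric]] by metis
  then have "lifts_to C p \<delta> y (pathfinish k)" by (auto simp: lifts_to_def)
  then show thesis by (rule that)
qed

lemma lifts_to_endpoints:
  assumes "lifts_to C p \<delta> y y'"
  shows "y \<in> C" "y' \<in> C" "p y = pathstart \<delta>" "p y' = pathfinish \<delta>"
  using assms pathstart_in_path_image pathfinish_in_path_image
  by (fastforce simp: lifts_to_def pathstart_def pathfinish_def)+

lemma lifts_to_unique:
  fixes \<delta> :: "real \<Rightarrow> 'b::real_normed_vector"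
  assumes cov: "covering_space C p S" and \<delta>: "path \<delta>" "path_image \<delta> \<subseteq> S"
    and "lifts_to C p \<delta> y y1" "lifts_to C p \<delta> y y2"
  shows "y1 = y2"
proof -
  obtain k1 where k1: "path k1" "path_image k1 \<subseteq> C" "pathstart k1 = y" "pathfinish k1 = y1"
      "\<And>s. s \<in> {0..1} \<Longrightarrow> p (k1 s) = \<delta> s"
    using assms(4) by (auto simp: lifts_to_def)
  obtain k2 where k2: "path k2" "path_image k2 \<subseteq> C" "pathstart k2 = y" "pathfinish k2 = y2"
      "\<And>s. s \<in> {0..1} \<Longrightarrow> p (k2 s) = \<delta> s"
    using assms(5) by (auto simp: lifts_to_def)
  have "k1 1 = k2 1"
    by (rule covering_space_lift_unique[OF cov, of k1 0 k2 "{0..1}" \<delta>])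
       (use k1 k2 \<delta> in \<open>auto simp: path_def path_image_def pathstart_def pathfinish_def\<close>)
  then show ?thesis using k1 k2 by (simp add: pathfinish_def)
qed

lemma lifts_to_reversepath:
  assumes "lifts_to C p \<delta> y y'"
  shows "lifts_to C p (reversepath \<delta>) y' y"
proof -
  obtain k where "path k" "path_image k \<subseteq> C" "pathstart k = y" "pathfinish k = y'"
      "\<forall>s\<in>{0..1}. p (k s) = \<delta> s"
    using assms by (auto simp: lifts_to_def)
  moreover from this have "p (reversepath k s) = reversepath \<delta> s" if "s \<in> {0..1}" for s
    using that unfolding reversepath_def by simp
  ultimately show ?thesis unfolding lifts_to_def
    by (intro exI[of _ "reversepath k"]) simp
qed

text \<open>Naturality of monodromy. With \<open>\<sigma>\<close> the identity it shows that \<open>g\<close> carries the monodromy of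
  \<open>f \<circ> g\<close> to that of \<open>f\<close>; with \<open>\<sigma>\<close> and \<open>\<kappa>\<close> complex conjugation it describes the monodromy of the
  conjugate path.\<close>

lemma lifts_to_image:
  assumes "lifts_to C p \<delta> y y'" and "continuous_on C \<kappa>" "\<kappa> ` C \<subseteq> C'"
    and "\<And>z. z \<in> C \<Longrightarrow> q (\<kappa> z) = \<sigma> (p z)"
  shows "lifts_to C' q (\<sigma> \<circ> \<delta>) (\<kappa> y) (\<kappa> y')"
proof -
  obtain k where k: "path k" "path_image k \<subseteq> C" "pathstart k = y" "pathfinish k = y'"
      "\<forall>s\<in>{0..1}. p (k s) = \<delta> s"
    using assms(1) by (auto simp: lifts_to_def)
  have "path (\<kappa> \<circ> k)"
    by (rule path_continuous_image) (use k assms(2) in \<open>auto intro: continuous_on_subset\<close>)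
  moreover have "path_image (\<kappa> \<circ> k) \<subseteq> C'"
    using k(2) assms(3) by (auto simp: path_image_compose)
  moreover have "q ((\<kappa> \<circ> k) s) = (\<sigma> \<circ> \<delta>) s" if "s \<in> {0..1}" for s
  proof -
    have "k s \<in> C" using that k(2) by (auto simp: path_image_def)
    then show ?thesis using assms(4) k(5) that by simp
  qed
  ultimately show ?thesis unfolding lifts_to_def
    using k(3,4) by (intro exI[of _ "\<kappa> \<circ> k"]) (simp add: pathstart_compose pathfinish_compose)
qed

text \<open>Monodromy of \<open>\<phi> = \<psi> \<circ> \<kappa>\<close> along any loop respects the fibres of \<open>\<kappa>\<close>, because the images under \<open>\<kappa>\<close>
  of two lifts are lifts along \<open>\<psi>\<close> and agree throughout once they agree at the start. Taking \<open>u\<close>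
  to be the monodromy along the image of a path from \<open>x0\<close> to \<open>x\<close>, the claim is
  \<open>dihedral_blocks\<close> for complex conjugation acting on the fibre of \<open>\<phi>\<close>.\<close>

lemma conjugate_blocks:
  fixes \<phi> \<psi> \<kappa> :: "complex \<Rightarrow> complex"
  assumes cov: "covering_space S \<phi> T" and cov': "covering_space S' \<psi> T"
    and conn: "path_connected S"
    and \<kappa>: "continuous_on S \<kappa>" "\<kappa> ` S \<subseteq> S'" "\<And>z. z \<in> S \<Longrightarrow> \<psi> (\<kappa> z) = \<phi> z"
    and cnjS: "\<And>z. z \<in> S \<Longrightarrow> cnj z \<in> S" and cnj\<phi>: "\<And>z. z \<in> S \<Longrightarrow> \<phi> (cnj z) = cnj (\<phi> z)"
    and x0: "x0 \<in> S" "cnj x0 = x0"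
    and fin: "finite {y \<in> S. \<phi> y = \<phi> x0}"
    and real_fibre: "\<And>y. y \<in> S \<Longrightarrow> \<phi> y = \<phi> x0 \<Longrightarrow> cnj y = y \<Longrightarrow> y = x0"
    and x: "x \<in> S" "\<phi> x = \<phi> x0" "\<kappa> x = \<kappa> x0"
  shows "\<kappa> (cnj x) = \<kappa> x0"
proof -
  define F where "F = {y \<in> S. \<phi> y = \<phi> x0}"
  have t: "cnj (\<phi> x0) = \<phi> x0" using cnj\<phi>[OF x0(1)] x0(2) by simp
  have \<phi>: "continuous_on S \<phi>" "\<phi> ` S = T"
    using cov by (auto simp: covering_space_imp_continuous covering_space_imp_surjective)
  obtain \<gamma> where \<gamma>: "path \<gamma>" "path_image \<gamma> \<subseteq> S" "pathstart \<gamma> = x0" "pathfinish \<gamma> = x"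
    using conn x0(1) x(1) unfolding path_connected_def by blast
  define \<delta> where "\<delta> = \<phi> \<circ> \<gamma>"
  have \<delta>: "path \<delta>" "path_image \<delta> \<subseteq> T" "pathstart \<delta> = \<phi> x0" "pathfinish \<delta> = \<phi> x0"
    using \<gamma> \<phi> x(2) unfolding \<delta>_def
    by (auto simp: path_image_compose pathstart_compose pathfinish_compose
        intro: path_continuous_image continuous_on_subset)
  have \<delta>': "path (cnj \<circ> \<delta>)" "path_image (cnj \<circ> \<delta>) \<subseteq> T"
  proof -
    show "path (cnj \<circ> \<delta>)"
      by (rule path_continuous_image) (use \<delta> in \<open>auto intro!: continuous_intros\<close>)
    show "path_image (cnj \<circ> \<delta>) \<subseteq> T"
      using \<gamma>(2) \<phi>(2) cnjS cnj\<phi> by (auto simp: \<delta>_def path_image_compose) (metis imageI subsetD)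
  qed
  have preserve: "\<kappa> a' = \<kappa> b'"
    if "path \<epsilon>" "path_image \<epsilon> \<subseteq> T" "lifts_to S \<phi> \<epsilon> a a'" "lifts_to S \<phi> \<epsilon> b b'" "\<kappa> a = \<kappa> b"
    for \<epsilon> a a' b b'
  proof -
    have "lifts_to S' \<psi> (id \<circ> \<epsilon>) (\<kappa> a) (\<kappa> a')" "lifts_to S' \<psi> (id \<circ> \<epsilon>) (\<kappa> b) (\<kappa> b')"
      by (intro lifts_to_image[OF that(3)] lifts_to_image[OF that(4)]; use \<kappa> in simp)+
    then show ?thesis using lifts_to_unique[OF cov' that(1,2)] that(5) by simp
  qed
  have preserve_iff: "\<kappa> a' = \<kappa> b' \<longleftrightarrow> \<kappa> a = \<kappa> b"
    if "path \<epsilon>" "path_image \<epsilon> \<subseteq> T" "lifts_to S \<phi> \<epsilon> a a'" "lifts_to S \<phi> \<epsilon> b b'" for \<epsilon> a a' b b'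
    using preserve[OF that] preserve[of "reversepath \<epsilon>" a' a b' b] that
    by (auto intro: lifts_to_reversepath)
  have "\<exists>y'. lifts_to S \<phi> \<delta> y y'" if "y \<in> F" for y
    using lifts_to_exists[OF cov \<delta>(1,2), of y] that \<delta>(3) by (auto simp: F_def)
  then obtain u where u: "\<And>y. y \<in> F \<Longrightarrow> lifts_to S \<phi> \<delta> y (u y)" by metis
  have uF: "u y \<in> F" if "y \<in> F" for y
    using lifts_to_endpoints[OF u[OF that]] \<delta>(4) by (simp add: F_def)
  have "inj_on u F"
  proof (rule inj_onI)
    fix a b assume "a \<in> F" "b \<in> F" "u a = u b"
    then show "a = b"
      using lifts_to_unique[OF cov, of "reversepath \<delta>" "u a" a b] \<delta>
        lifts_to_reversepath[OF u[of a]] lifts_to_reversepath[OF u[of b]] by simp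
  qed
  then have bij: "bij_betw u F F"
    using endo_inj_surj[of F u] fin uF by (auto simp: bij_betw_def F_def)
  have cF: "cnj y \<in> F" if "y \<in> F" for y
    using that cnjS cnj\<phi> t by (auto simp: F_def)
  have cu: "lifts_to S \<phi> (cnj \<circ> \<delta>) y (cnj (u (cnj y)))" if "y \<in> F" for y
  proof -
    have "lifts_to S \<phi> (cnj \<circ> \<delta>) (cnj (cnj y)) (cnj (u (cnj y)))"
      by (rule lifts_to_image[OF u[OF cF[OF that]]])
         (use cnjS cnj\<phi> in \<open>auto intro!: continuous_intros\<close>)
    then show ?thesis by simp
  qed
  have "x0 \<in> F" using x0 by (simp add: F_def)
  \<comment> \<open>The path \<open>\<gamma>\<close> itself is the lift that starts at \<open>x0\<close>.\<close>
  have "lifts_to S \<phi> \<delta> x0 x"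
    unfolding lifts_to_def using \<gamma> by (intro exI[of _ \<gamma>]) (simp add: \<delta>_def)
  then have ux: "u x0 = x" using lifts_to_unique[OF cov \<delta>(1,2)] u[OF \<open>x0 \<in> F\<close>] by blast
  have "\<kappa> (cnj (u x0)) = \<kappa> x0"
  proof (rule dihedral_blocks[where F = F and c = cnj and u = u and \<kappa> = \<kappa>])
    show "finite F" "x0 \<in> F" "bij_betw u F F" by (use fin \<open>x0 \<in> F\<close> bij in \<open>auto simp: F_def\<close>)
    show "cnj y = y \<longleftrightarrow> y = x0" if "y \<in> F" for y
      using that real_fibre x0(2) by (auto simp: F_def)
    show "\<kappa> (u a) = \<kappa> (u b) \<longleftrightarrow> \<kappa> a = \<kappa> b" if "a \<in> F" "b \<in> F" for a b
      using preserve_iff[OF \<delta>(1,2)] u that by blast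
    show "\<kappa> (cnj (u (cnj a))) = \<kappa> (cnj (u (cnj b))) \<longleftrightarrow> \<kappa> a = \<kappa> b" if "a \<in> F" "b \<in> F" for a b
      using preserve_iff[OF \<delta>'] cu that by blast
    show "\<kappa> (u x0) = \<kappa> x0" using ux x(3) by simp
  qed (use cF in auto)
  then show ?thesis using ux by simp
qed

section \<open>Real points alone in their fibre\<close>

lemma fraction_map_eq_iff_cross:
  assumes "coprime p q"
  shows "fraction_map p q (Some y) = fraction_map p q (Some z)
    \<longleftrightarrow> poly p z * poly q y = poly q z * poly p y"
  using coprime_poly_0[OF assms, of y] coprime_poly_0[OF assms, of z]
  by (auto simp: fraction_map_def field_simps)

lemma fraction_map_infinity_eq_cross:
  assumes "coprime p q" "q \<noteq> 0" and N: "N = max (degree p) (degree q)"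
    and "poly p z * coeff q N = poly q z * coeff p N"
  shows "fraction_map p q None = fraction_map p q (Some z)"
proof (cases "degree p > degree q")
  case True
  then have "coeff q N = 0" "coeff p N \<noteq> 0" using N by (auto simp: coeff_eq_0)
  then show ?thesis using True assms(4) by (simp add: fraction_map_def)
next
  case False
  then have "N = degree q" using N by simp
  then have "coeff q N \<noteq> 0" using assms(2) by simp
  moreover from this have "poly q z \<noteq> 0"
    using assms(4) coprime_poly_0[OF assms(1), of z] by auto
  ultimately show ?thesis
    using False assms(4) \<open>N = degree q\<close> by (simp add: fraction_map_def field_simps)
qed

definition homogenized :: "complex poly \<Rightarrow> nat \<Rightarrow> complex \<Rightarrow> complex \<Rightarrow> complex" where
  "homogenized p N u v = (\<Sum>i\<le>N. coeff p i * u ^ i * v ^ (N - i))"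

lemma homogenized_nonzero:
  assumes "degree p \<le> N" "v \<noteq> 0"
  shows "homogenized p N u v = v ^ N * poly p (u / v)"
proof -
  have "poly p (u / v) = (\<Sum>i\<le>N. coeff p i * (u / v) ^ i)"
    unfolding poly_altdef using assms(1)
    by (intro sum.mono_neutral_left) (auto simp: coeff_eq_0)
  then show ?thesis
    using assms(2) unfolding homogenized_def
    by (auto simp: sum_distrib_left power_diff power_divide intro!: sum.cong)
qed

lemma homogenized_infinity: "homogenized p N 1 0 = coeff p N"
proof -
  have "homogenized p N 1 0 = (\<Sum>i\<in>{N}. coeff p i)"
    unfolding homogenized_def
    by (intro sum.mono_neutral_cong_right) (auto simp: power_0_left)
  then show ?thesis by simp
qed

text \<open>If \<open>x0\<close> is the only point of the extended real line with its value, then the values on the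
  compact set of points far from \<open>x0\<close> stay away from the values near \<open>x0\<close>; near \<open>x0\<close> itself the map
  is injective on the real line.\<close>

lemma single_real_fibres:
  fixes x0 :: real
  assumes cop: "coprime p q" and q: "q \<noteq> 0" and "\<epsilon> > 0"
    and inj: "\<And>x y :: real. \<bar>x - x0\<bar> < \<epsilon> \<Longrightarrow> \<bar>y - x0\<bar> < \<epsilon> \<Longrightarrow>
      fraction_map p q (Some x) = fraction_map p q (Some y) \<Longrightarrow> x = y"
    and alone: "\<And>y :: real. y \<noteq> x0 \<Longrightarrow> fraction_map p q (Some y) \<noteq> fraction_map p q (Some x0)"
    and alone_inf: "fraction_map p q None \<noteq> fraction_map p q (Some x0)"
  shows "\<exists>e>0. \<forall>x y :: real. \<bar>x - x0\<bar> < e \<longrightarrow>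
      fraction_map p q (Some y) = fraction_map p q (Some x) \<longrightarrow> y = x"
proof -
  define N where "N = max (degree p) (degree q)"
  have deg: "degree p \<le> N" "degree q \<le> N" by (auto simp: N_def)
  \<comment> \<open>Up to the factor \<open>s ^ N\<close>, \<open>E (x, s)\<close> is the cross product of the values at \<open>x\<close> and at
    \<open>x0 + 1 / s\<close>, which vanishes exactly when they agree; at \<open>s = 0\<close> the second point is infinity.\<close>
  define E :: "real \<times> real \<Rightarrow> complex" where
    "E = (\<lambda>(x, s). poly p x * homogenized q N (1 + s * x0) s - poly q x * homogenized p N (1 + s * x0) s)"
  have E: "E (x, s) = s ^ N * (poly p x * poly q (x0 + 1 / s) - poly q x * poly p (x0 + 1 / s))"
    if "s \<noteq> 0" for x s :: real
  proof -
    have "(1 + of_real s * of_real x0) / of_real s = of_real x0 + 1 / (of_real s :: complex)"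
      using that by (simp add: field_simps)
    then show ?thesis using that deg by (simp add: E_def homogenized_nonzero algebra_simps)
  qed
  define W where "W = {z. E z \<noteq> 0}"
  have "open W"
    unfolding W_def E_def case_prod_unfold homogenized_def
    by (intro open_Collect_neq continuous_intros)
  \<comment> \<open>A real point at distance at least \<open>\<epsilon>\<close> from \<open>x0\<close>, or infinity, is \<open>x0 + 1 / s\<close> with \<open>s\<close> in
    the compact set \<open>K\<close>.\<close>
  define K where "K = cball (0 :: real) (1 / \<epsilon>)"
  have "{x0} \<times> K \<subseteq> W"
  proof clarify
    fix s assume "s \<in> K"
    show "(x0, s) \<in> W"
    proof (cases "s = 0")
      case True
      then have "E (x0, s) = poly p x0 * coeff q N - poly q x0 * coeff p N"
        by (simp add: E_def homogenized_infinity)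
      then show ?thesis
        using fraction_map_infinity_eq_cross[OF cop q N_def, of x0] alone_inf by (auto simp: W_def)
    next
      case False
      then have "fraction_map p q (Some (of_real (x0 + 1 / s))) \<noteq> fraction_map p q (Some x0)"
        by (intro alone) simp
      then show ?thesis
        using False unfolding fraction_map_eq_iff_cross[OF cop] by (simp add: W_def E)
    qed
  qed
  then obtain X where X: "x0 \<in> X" "open X" "X \<times> K \<subseteq> W"
    using Elementary_Topology.tube_lemma[of K W x0] \<open>open W\<close> by (auto simp: K_def)
  then obtain e where e: "e > 0" "ball x0 e \<subseteq> X" by (metis openE)
  show ?thesis
  proof (intro exI[of _ "min e \<epsilon>"] conjI allI impI)
    show "min e \<epsilon> > 0" using e \<open>\<epsilon> > 0\<close> by simp
    fix x y :: real
    assume x: "\<bar>x - x0\<bar> < min e \<epsilon>" and eq: "fraction_map p q (Some y) = fraction_map p q (Some x)"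
    have "\<bar>y - x0\<bar> < \<epsilon>"
    proof (rule ccontr)
      assume far: "\<not> \<bar>y - x0\<bar> < \<epsilon>"
      define s where "s = 1 / (y - x0)"
      have s: "s \<noteq> 0" "x0 + 1 / s = y" using far \<open>\<epsilon> > 0\<close> by (auto simp: s_def)
      have "\<bar>s\<bar> = 1 / \<bar>y - x0\<bar>" by (simp add: s_def)
      also have "\<dots> \<le> 1 / \<epsilon>" using far \<open>\<epsilon> > 0\<close> by (intro divide_left_mono) auto
      finally have "s \<in> K" by (simp add: K_def)
      moreover have "x \<in> X" using x e(2) by (auto simp: dist_real_def abs_minus_commute)
      ultimately have "E (x, s) \<noteq> 0" using X(3) by (auto simp: W_def)
      moreover have "complex_of_real x0 + 1 / of_real s = of_real y"
        using s(2) by (metis of_real_1 of_real_add of_real_divide)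
      ultimately show False
        using eq s(1) unfolding fraction_map_eq_iff_cross[OF cop] by (simp add: E)
    qed
    then show "y = x" using inj[OF _ _ eq] x by simp
  qed
qed

section \<open>The conjugate function as a linear fractional expression\<close>

lemma finite_cnj_irregular_values:
  assumes "coprime p q" "0 < max (degree p) (degree q)"
  shows "finite {t. \<not> regular_value p q (cnj t)}"
proof -
  have "{t. \<not> regular_value p q (cnj t)} = cnj -` {t. \<not> regular_value p q t}" by auto
  moreover have "finite (cnj -` {t. \<not> regular_value p q t})"
    using finite_irregular_values[OF assms] by (rule finite_vimageI) (simp add: inj_def)
  ultimately show ?thesis by simp
qed

text \<open>Values that are regular for both \<open>k / l\<close> and \<open>p / q\<close>, together with their conjugates; the
  symmetry keeps the preimage of this set stable under conjugation.\<close>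

definition good_values ::
  "complex poly \<Rightarrow> complex poly \<Rightarrow> complex poly \<Rightarrow> complex poly \<Rightarrow> complex set" where
  "good_values k l p q = {t. \<forall>s\<in>{t, cnj t}. regular_value k l s \<and> regular_value p q s}"

lemma finite_compl_good_values:
  assumes "coprime k l" "0 < max (degree k) (degree l)" "coprime p q" "0 < max (degree p) (degree q)"
  shows "finite (- good_values k l p q)"
proof -
  have "- good_values k l p q \<subseteq> {t. \<not> regular_value k l t} \<union> {t. \<not> regular_value k l (cnj t)} \<union>
      {t. \<not> regular_value p q t} \<union> {t. \<not> regular_value p q (cnj t)}"
    by (auto simp: good_values_def)
  then show ?thesis
    by (rule finite_subset)
       (use assms finite_irregular_values finite_cnj_irregular_values in simp)
qed

text \<open>This transfers \<open>conjugate_blocks\<close> to maps of the sphere. Over good values nothing happens at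
  infinity: if \<open>a / b\<close> had a pole at \<open>y\<close>, the value of \<open>p / q\<close> at \<open>y\<close> would be that of \<open>k / l\<close> at
  infinity, which is not regular.\<close>

lemma conjugate_point_same_value:
  fixes x :: real
  assumes kl: "coprime k l" "l \<noteq> 0" "0 < max (degree k) (degree l)"
    and ab: "coprime a b"
    and pq: "coprime p q" "q \<noteq> 0" "0 < max (degree p) (degree q)"
    and comp: "\<And>z. fraction_map k l (fraction_map a b z) = fraction_map p q z"
    and real_coeffs: "\<And>i. coeff p i \<in> \<real>" "\<And>i. coeff q i \<in> \<real>"
    and x: "poly q x \<noteq> 0" "plane_map p q x \<in> good_values k l p q"
    and single: "\<And>y :: real. fraction_map p q (Some y) = fraction_map p q (Some x) \<Longrightarrow> y = x"
    and z: "fraction_map a b (Some z) = fraction_map a b (Some x)"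
  shows "plane_map a b (cnj z) = plane_map a b x" "poly b (cnj z) \<noteq> 0"
proof -
  define T where "T = good_values k l p q"
  define S where "S = plane_preimage p q T"
  define S' where "S' = plane_preimage k l T"
  have finT: "finite (- T)"
    unfolding T_def by (rule finite_compl_good_values[OF kl(1,3) pq(1,3)])
  have "open T" using finite_imp_closed[OF finT] by (simp add: closed_def)
  have T: "regular_value k l t" "regular_value p q t" "cnj t \<in> T" if "t \<in> T" for t
    using that by (auto simp: T_def good_values_def)
  have \<kappa>: "poly b y \<noteq> 0" "plane_map a b y \<in> S'" "plane_map k l (plane_map a b y) = plane_map p q y"
    if "y \<in> S" for y
  proof -
    have y: "plane_map p q y \<in> T" "fraction_map p q (Some y) = Some (plane_map p q y)"
      using that fraction_map_Some_iff by (auto simp: S_def plane_preimage_def)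
    then have "fraction_map k l (fraction_map a b (Some y)) = Some (plane_map p q y)"
      using comp by simp
    then have fin: "fraction_map a b (Some y) \<noteq> None"
      using regular_value_infinity[OF T(1)[OF y(1)] kl(2)] by metis
    then show "poly b y \<noteq> 0" by (auto simp: fraction_map_def)
    then have "fraction_map a b (Some y) = Some (plane_map a b y)"
      using fraction_map_Some_iff by simp
    then have "fraction_map k l (Some (plane_map a b y)) = Some (plane_map p q y)"
      using comp[of "Some y"] y(2) by simp
    then have "poly l (plane_map a b y) \<noteq> 0 \<and> plane_map k l (plane_map a b y) = plane_map p q y"
      unfolding fraction_map_Some_iff .
    then show "plane_map a b y \<in> S'" "plane_map k l (plane_map a b y) = plane_map p q y"
      using y(1) by (auto simp: S'_def plane_preimage_def)
  qed
  have cnj_poly: "poly p (cnj y) = cnj (poly p y)" "poly q (cnj y) = cnj (poly q y)" for y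
    using real_coeffs by (simp_all add: poly_cnj_real)
  have cnj_map: "plane_map p q (cnj y) = cnj (plane_map p q y)" for y
    by (simp add: plane_map_def cnj_poly)
  have cnjS: "cnj y \<in> S" if "y \<in> S" for y
    using that T(3) by (auto simp: S_def plane_preimage_def cnj_map cnj_poly)
  have xS: "complex_of_real x \<in> S" using x by (simp add: S_def plane_preimage_def T_def)
  have hx: "fraction_map p q (Some x) = Some (plane_map p q x)"
    using x(1) fraction_map_Some_iff by blast
  have "fraction_map p q (Some z) = Some (plane_map p q x)"
    using comp[of "Some z"] comp[of "Some x"] z hx by simp
  then have hz: "poly q z \<noteq> 0" "plane_map p q z = plane_map p q x"
    using fraction_map_Some_iff by auto
  have zS: "z \<in> S" using hz x(2) by (simp add: S_def plane_preimage_def T_def)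
  have "fraction_map a b (Some z) = Some (plane_map a b z)" "fraction_map a b (Some x) = Some (plane_map a b x)"
    using \<kappa>(1)[OF zS] \<kappa>(1)[OF xS] fraction_map_Some_iff by blast+
  then have gz: "plane_map a b z = plane_map a b x" using z by simp
  have "plane_map a b (cnj z) = plane_map a b (complex_of_real x)"
  proof (rule conjugate_blocks[where S = S and T = T and S' = S' and \<phi> = "plane_map p q" and \<psi> = "plane_map k l"])
    show "covering_space S (plane_map p q) T" unfolding S_def
      by (rule covering_space_plane_map[OF pq(1,3) \<open>open T\<close> T(2)])
    show "covering_space S' (plane_map k l) T" unfolding S'_def
      by (rule covering_space_plane_map[OF kl(1,3) \<open>open T\<close> T(1)])
    show "path_connected S" unfolding S_def
      by (rule path_connected_plane_preimage[OF pq(2) finite_plane_fibre[OF pq(1,3)] finT])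
    show "continuous_on S (plane_map a b)"
      unfolding plane_map_def by (intro continuous_intros) (use \<kappa>(1) in auto)
    show "plane_map a b ` S \<subseteq> S'" using \<kappa>(2) by blast
    show "finite {y \<in> S. plane_map p q y = plane_map p q x}"
      by (rule finite_subset[OF _ finite_plane_fibre[OF pq(1,3), of "plane_map p q x"]])
         (auto simp: S_def plane_preimage_def)
    show "y = x" if y: "y \<in> S" "plane_map p q y = plane_map p q x" "cnj y = y" for y
    proof -
      have "y \<in> \<real>" using y(3) by (simp add: Reals_cnj_iff)
      then obtain r :: real where r: "y = of_real r" by (rule Reals_cases)
      have "fraction_map p q (Some y) = Some (plane_map p q x)"
        using y unfolding fraction_map_Some_iff S_def plane_preimage_def by simp
      then have "fraction_map p q (Some y) = fraction_map p q (Some x)"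
        unfolding hx .
      then show ?thesis using single r by blast
    qed
  qed (use \<kappa>(3) cnjS cnj_map xS zS hz gz in simp_all)
  then show "plane_map a b (cnj z) = plane_map a b x" .
  show "poly b (cnj z) \<noteq> 0" using \<kappa>(1)[OF cnjS[OF zS]] .
qed

lemma proportional_if_roots_contained:
  fixes P Q :: "complex poly"
  assumes "degree P = N" "N > 0" "card {z. poly P z = 0} = N" "degree Q \<le> N"
    and "\<And>z. poly P z = 0 \<Longrightarrow> poly Q z = 0"
  obtains c where "Q = smult c P"
proof
  have "coeff P N \<noteq> 0" using assms(1,2) by (metis degree_0 leading_coeff_0_iff less_irrefl)
  show "Q = smult (coeff Q N / coeff P N) P"
    by (rule poly_eqI_degree_lead_coeff[where n = N and A = "{z. poly P z = 0}"])
       (use assms \<open>coeff P N \<noteq> 0\<close> in \<open>auto intro: order_trans[OF degree_smult_le]\<close>)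
qed

text \<open>The polynomial on the right has as many distinct roots as its degree allows, namely the fibre of
  \<open>a / b\<close> through \<open>x\<close>. The one on the left vanishes at the conjugates of the points where \<open>a / b\<close>
  takes its value at \<open>x\<close>, so the hypothesis makes it vanish on that fibre.\<close>

lemma conjugate_pencil:
  fixes x :: complex
  assumes ab: "coprime a b" "0 < max (degree a) (degree b)"
    and x: "poly b x \<noteq> 0" "regular_value a b (plane_map a b x)"
    and conj_fibre: "\<And>z. fraction_map a b (Some z) = fraction_map a b (Some x) \<Longrightarrow>
      poly b (cnj z) \<noteq> 0 \<and> plane_map a b (cnj z) = plane_map a b x"
  obtains c where "smult (cnj (poly b x)) (map_poly cnj a) - smult (cnj (poly a x)) (map_poly cnj b) =
    smult c (smult (poly b x) a - smult (poly a x) b)"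
proof -
  define w where "w = plane_map a b x"
  define N where "N = max (degree a) (degree b)"
  define P where "P = smult (poly b x) a - smult (poly a x) b"
  define Q where "Q = smult (cnj (poly b x)) (map_poly cnj a) - smult (cnj (poly a x)) (map_poly cnj b)"
  have ax: "poly a x = w * poly b x" using x(1) by (simp add: w_def plane_map_def)
  have P: "P = smult (poly b x) (a - smult w b)"
    unfolding P_def ax by (simp add: smult_diff_right mult.commute)
  have roots: "{z. poly P z = 0} = {z. poly b z \<noteq> 0 \<and> plane_map a b z = w}"
    using x(1) unfolding P plane_map_eq_iff[OF ab(1), symmetric] by simp
  have regw: "regular_value a b w" using x(2) by (simp add: w_def)
  have degP: "degree P = N"
    using x(1) regw by (simp add: P N_def regular_value_def)
  have cardP: "card {z. poly P z = 0} = N"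
    unfolding roots N_def by (rule regular_fibre(2)[OF ab(1) regw])
  have degQ: "degree Q \<le> N"
    unfolding Q_def N_def
    by (intro degree_diff_le order_trans[OF degree_smult_le] order_trans[OF map_poly_degree_leq]) auto
  have "poly Q z = 0" if "poly P z = 0" for z
  proof -
    have "fraction_map a b (Some z) = Some w" "fraction_map a b (Some x) = Some w"
      using that roots x(1) fraction_map_Some_iff by (auto simp: w_def)
    then have "poly b (cnj z) \<noteq> 0" "plane_map a b (cnj z) = w"
      using conj_fibre[of z] by (auto simp: w_def)
    then have "poly a (cnj z) = w * poly b (cnj z)" by (auto simp: plane_map_def)
    then show ?thesis by (simp add: Q_def ax)
  qed
  then obtain c where "Q = smult c P"
    using proportional_if_roots_contained[OF degP _ cardP degQ] ab(2) by (auto simp: N_def)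
  then show thesis using that by (simp add: P_def Q_def)
qed

lemma conjugate_is_Moebius:
  fixes x1 x2 :: complex
  assumes b: "poly b x1 \<noteq> 0" "poly b x2 \<noteq> 0"
    and neq: "plane_map a b x1 \<noteq> plane_map a b x2"
    and "smult (cnj (poly b x1)) (map_poly cnj a) - smult (cnj (poly a x1)) (map_poly cnj b) =
      smult c1 (smult (poly b x1) a - smult (poly a x1) b)"
    and "smult (cnj (poly b x2)) (map_poly cnj a) - smult (cnj (poly a x2)) (map_poly cnj b) =
      smult c2 (smult (poly b x2) a - smult (poly a x2) b)"
  obtains \<alpha> \<beta> \<gamma> \<delta> where "\<gamma> \<noteq> 0 \<or> \<delta> \<noteq> 0"
    "map_poly cnj a = smult \<alpha> a + smult \<beta> b" "map_poly cnj b = smult \<gamma> a + smult \<delta> b"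
proof -
  define A1 A2 B1 B2 where AB: "A1 = cnj (poly a x1)" "A2 = cnj (poly a x2)"
    "B1 = cnj (poly b x1)" "B2 = cnj (poly b x2)"
  \<comment> \<open>The two pencil identities form a linear system for the conjugates of \<open>a\<close> and \<open>b\<close>, with
    determinant \<open>- D\<close>.\<close>
  define D where "D = B1 * A2 - B2 * A1"
  have "cnj D \<noteq> 0"
    using b neq by (simp add: D_def AB plane_map_def field_simps)
  then have "D \<noteq> 0" by simp
  have v1: "smult B1 (map_poly cnj a) - smult A1 (map_poly cnj b) =
      smult (c1 * poly b x1) a - smult (c1 * poly a x1) b"
    and v2: "smult B2 (map_poly cnj a) - smult A2 (map_poly cnj b) =
      smult (c2 * poly b x2) a - smult (c2 * poly a x2) b"
    using assms(4,5) by (simp_all add: AB smult_diff_right)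
  have solve: "X = smult ((m * (c1 * poly b x1) - n * (c2 * poly b x2)) / D) a +
      smult (- (m * (c1 * poly a x1) - n * (c2 * poly a x2)) / D) b"
    if "smult D X = smult m (smult B1 (map_poly cnj a) - smult A1 (map_poly cnj b)) -
      smult n (smult B2 (map_poly cnj a) - smult A2 (map_poly cnj b))" for m n X
  proof (rule poly_eqI)
    fix i
    have "D * coeff X i = m * (c1 * poly b x1 * coeff a i - c1 * poly a x1 * coeff b i) -
        n * (c2 * poly b x2 * coeff a i - c2 * poly a x2 * coeff b i)"
      using arg_cong[OF that[unfolded v1 v2], of "\<lambda>p. coeff p i"] by simp
    then have "coeff X i = (m * (c1 * poly b x1 * coeff a i - c1 * poly a x1 * coeff b i) -
        n * (c2 * poly b x2 * coeff a i - c2 * poly a x2 * coeff b i)) / D"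
      using \<open>D \<noteq> 0\<close> by (simp add: eq_divide_eq mult.commute)
    then show "coeff X i = coeff (smult ((m * (c1 * poly b x1) - n * (c2 * poly b x2)) / D) a +
      smult (- (m * (c1 * poly a x1) - n * (c2 * poly a x2)) / D) b) i"
      by (simp add: ring_distribs add_divide_distrib diff_divide_distrib mult_ac)
  qed
  have "smult D (map_poly cnj a) = smult A2 (smult B1 (map_poly cnj a) - smult A1 (map_poly cnj b)) -
      smult A1 (smult B2 (map_poly cnj a) - smult A2 (map_poly cnj b))"
    "smult D (map_poly cnj b) = smult B2 (smult B1 (map_poly cnj a) - smult A1 (map_poly cnj b)) -
      smult B1 (smult B2 (map_poly cnj a) - smult A2 (map_poly cnj b))"
    by (rule poly_eqI, simp add: D_def algebra_simps)+
  note eqs = this[THEN solve]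
  have "map_poly cnj b \<noteq> 0"
    using b(1) poly_map_poly_cnj[of b "cnj x1"] by force
  then show thesis using that[OF _ eqs] eqs(2) by (metis add_0 smult_0_left)
qed

section \<open>Circles\<close>

text \<open>Such an equation describes a line when \<open>A = 0\<close>, and otherwise, on completing the square, a circle
  centred at \<open>- cnj B / (2 A)\<close>. The two points exclude the empty set and a circle of radius zero.\<close>

lemma is_circle_real_equation:
  fixes A C :: real and B :: complex
  assumes nz: "A \<noteq> 0 \<or> B \<noteq> 0 \<or> C \<noteq> 0"
    and eq: "\<And>w. Some w \<in> \<Gamma> \<Longrightarrow> A * (cmod w)\<^sup>2 + Re (B * w) + C = 0"
    and inf: "None \<in> \<Gamma> \<Longrightarrow> A = 0"
    and two: "Some w1 \<in> \<Gamma>" "Some w2 \<in> \<Gamma>" "w1 \<noteq> w2"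
  shows "\<exists>D. is_circle D \<and> \<Gamma> \<subseteq> D"
proof (cases "A = 0")
  case True
  have "B \<noteq> 0" using nz eq[OF two(1)] True by auto
  \<comment> \<open>The line is \<open>Re (B w) = - C\<close>: its point closest to the origin, and its direction.\<close>
  define a where "a = - of_real C * cnj B / of_real ((cmod B)\<^sup>2)"
  define b where "b = \<i> * cnj B"
  let ?D = "insert None (Some ` range (\<lambda>t::real. a + of_real t * b))"
  have "x \<in> ?D" if "x \<in> \<Gamma>" for x
  proof (cases x)
    case (Some w)
    have "Re (B * w) = - C" using eq that Some True by force
    then obtain y :: real where Bw: "B * w = - of_real C + \<i> * of_real y"
      by (metis complex_eq of_real_minus)
    have B2: "of_real ((cmod B)\<^sup>2) = B * cnj B" by (rule complex_norm_square)
    have "w = cnj B * (B * w) / of_real ((cmod B)\<^sup>2)"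
      using \<open>B \<noteq> 0\<close> unfolding B2 by (simp add: field_simps)
    also have "\<dots> = a + of_real (y / (cmod B)\<^sup>2) * b"
      unfolding a_def b_def Bw by (simp add: ring_distribs add_divide_distrib diff_divide_distrib mult_ac)
    finally show ?thesis using Some by blast
  qed simp
  moreover have "is_circle ?D"
    using \<open>B \<noteq> 0\<close> unfolding is_circle_def
    by (intro disjI2 exI[of _ a] exI[of _ b]) (simp add: b_def)
  ultimately show ?thesis by blast
next
  case False
  define c where "c = - cnj B / of_real (2 * A)"
  have dist: "(dist c w)\<^sup>2 = (cmod c)\<^sup>2 - C / A" if "Some w \<in> \<Gamma>" for w
  proof -
    have "(dist c w)\<^sup>2 = (cmod w)\<^sup>2 + Re (B * w) / A + (cmod c)\<^sup>2"
      using False unfolding dist_norm cmod_power2 c_def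
      by (simp add: Re_divide_of_real Im_divide_of_real power2_eq_square field_simps)
    also have "\<dots> = (A * (cmod w)\<^sup>2 + Re (B * w) + C) / A + (cmod c)\<^sup>2 - C / A"
      using False by (simp add: field_simps)
    finally show ?thesis using eq[OF that] by simp
  qed
  define r where "r = dist c w1"
  have r: "dist c w = r" if "Some w \<in> \<Gamma>" for w
    unfolding r_def using dist[OF that] dist[OF two(1)]
    by (intro power2_eq_imp_eq[OF _ zero_le_dist zero_le_dist]) simp
  have "r > 0"
  proof (rule ccontr)
    assume "\<not> r > 0"
    then have "r = 0" using zero_le_dist[of c w1] unfolding r_def by linarith
    then have "dist c w1 = 0" "dist c w2 = 0" using r[OF two(1)] r[OF two(2)] by auto
    then show False using two(3) by simp
  qed
  have "\<Gamma> \<subseteq> Some ` sphere c r"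
  proof
    fix x assume "x \<in> \<Gamma>"
    then show "x \<in> Some ` sphere c r" using inf False r by (cases x) auto
  qed
  moreover have "is_circle (Some ` sphere c r)"
    using \<open>r > 0\<close> by (auto simp: is_circle_def)
  ultimately show ?thesis by blast
qed

text \<open>The real and the imaginary part of the relation are both equations of the form treated in
  \<open>is_circle_real_equation\<close>, and they cannot both be trivial.\<close>

lemma is_circle_conjugate_Moebius:
  fixes \<alpha> \<beta> \<gamma> \<delta> :: complex
  assumes nz: "\<gamma> \<noteq> 0 \<or> \<delta> \<noteq> 0"
    and eq: "\<And>w. Some w \<in> \<Gamma> \<Longrightarrow> cnj w * (\<gamma> * w + \<delta>) = \<alpha> * w + \<beta>"
    and inf: "None \<in> \<Gamma> \<Longrightarrow> \<gamma> = 0"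
    and two: "Some w1 \<in> \<Gamma>" "Some w2 \<in> \<Gamma>" "w1 \<noteq> w2"
  shows "\<exists>D. is_circle D \<and> \<Gamma> \<subseteq> D"
proof -
  have re: "Re \<gamma> * (cmod w)\<^sup>2 + Re ((cnj \<delta> - \<alpha>) * w) + (- Re \<beta>) = 0"
    and im: "Im \<gamma> * (cmod w)\<^sup>2 + Re ((\<i> * (cnj \<delta> + \<alpha>)) * w) + (- Im \<beta>) = 0"
    if "Some w \<in> \<Gamma>" for w
    using arg_cong[OF eq[OF that], of Re] arg_cong[OF eq[OF that], of Im]
    unfolding cmod_power2 by (simp_all add: power2_eq_square algebra_simps)
  show ?thesis
  proof (cases "Re \<gamma> \<noteq> 0 \<or> cnj \<delta> - \<alpha> \<noteq> 0 \<or> - Re \<beta> \<noteq> 0")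
    case True
    then show ?thesis by (rule is_circle_real_equation) (use re inf two in auto)
  next
    case False
    then have "Im \<gamma> \<noteq> 0 \<or> \<i> * (cnj \<delta> + \<alpha>) \<noteq> 0 \<or> - Im \<beta> \<noteq> 0"
      using nz by (auto simp: complex_eq_iff)
    then show ?thesis by (rule is_circle_real_equation) (use im inf two in auto)
  qed
qed

text \<open>At real points, \<open>a\<close> and \<open>b\<close> take values conjugate to those of their conjugate polynomials, so
  the relation between the polynomials becomes one between a point of the curve and its conjugate.\<close>

lemma image_in_circle:
  assumes ab: "coprime a b" "b \<noteq> 0"
    and nz: "\<gamma> \<noteq> 0 \<or> \<delta> \<noteq> 0"
    and cnj_a: "map_poly cnj a = smult \<alpha> a + smult \<beta> b"
    and cnj_b: "map_poly cnj b = smult \<gamma> a + smult \<delta> b"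
    and two: "Some w1 \<in> fraction_map a b ` extended_reals" "Some w2 \<in> fraction_map a b ` extended_reals" "w1 \<noteq> w2"
  shows "\<exists>C. is_circle C \<and> fraction_map a b ` extended_reals \<subseteq> C"
proof -
  have point: "cnj (poly a x) = \<alpha> * poly a x + \<beta> * poly b x"
    "cnj (poly b x) = \<gamma> * poly a x + \<delta> * poly b x" if "x \<in> \<real>" for x
    using arg_cong[OF cnj_a, of "\<lambda>p. poly p x"] arg_cong[OF cnj_b, of "\<lambda>p. poly p x"] that
    by (simp_all add: Reals_cnj_iff)
  have coeffs: "cnj (coeff a n) = \<alpha> * coeff a n + \<beta> * coeff b n"
    "cnj (coeff b n) = \<gamma> * coeff a n + \<delta> * coeff b n" for n
    using arg_cong[OF cnj_a, of "\<lambda>p. coeff p n"] arg_cong[OF cnj_b, of "\<lambda>p. coeff p n"]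
    by (simp_all add: coeff_map_poly)
  \<comment> \<open>A point of the curve is a ratio \<open>A : B\<close>, of values at a real point or of top coefficients.\<close>
  have ratio: "\<exists>A B. (A \<noteq> 0 \<or> B \<noteq> 0) \<and> y = (if B = 0 then None else Some (A / B)) \<and>
      cnj A = \<alpha> * A + \<beta> * B \<and> cnj B = \<gamma> * A + \<delta> * B"
    if y: "y \<in> fraction_map a b ` extended_reals" for y
  proof -
    obtain x where x: "x \<in> extended_reals" "y = fraction_map a b x" using y by blast
    show ?thesis
    proof (cases x)
      case (Some z)
      then have "z \<in> \<real>" using x(1) by (auto simp: extended_reals_def)
      then show ?thesis using Some x(2) point[of z] coprime_poly_0[OF ab(1), of z]
        by (intro exI[of _ "poly a z"] exI[of _ "poly b z"]) (simp add: fraction_map_def)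
    next
      case None
      show ?thesis
      proof (cases "degree a > degree b")
        case True
        then have "coeff a (degree a) \<noteq> 0" "coeff b (degree a) = 0" by (auto simp: coeff_eq_0)
        then show ?thesis using True None x(2) coeffs[of "degree a"]
          by (intro exI[of _ "coeff a (degree a)"] exI[of _ "coeff b (degree a)"]) (simp add: fraction_map_def)
      next
        case False
        then show ?thesis using None x(2) coeffs[of "degree b"] ab(2)
          by (intro exI[of _ "coeff a (degree b)"] exI[of _ "coeff b (degree b)"]) (simp add: fraction_map_def)
      qed
    qed
  qed
  show ?thesis
  proof (rule is_circle_conjugate_Moebius[OF nz _ _ two])
    fix w assume "Some w \<in> fraction_map a b ` extended_reals"
    from ratio[OF this] obtain A B where AB: "B \<noteq> 0" "w = A / B"
      "cnj A = \<alpha> * A + \<beta> * B" "cnj B = \<gamma> * A + \<delta> * B"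
      by (auto split: if_splits)
    have "cnj B \<noteq> 0" using AB(1) by simp
    have "\<gamma> * w + \<delta> = cnj B / B" "\<alpha> * w + \<beta> = cnj A / B"
      unfolding AB(3,4) using AB(1,2) by (simp_all add: field_simps)
    then show "cnj w * (\<gamma> * w + \<delta>) = \<alpha> * w + \<beta>"
      using AB(2) \<open>cnj B \<noteq> 0\<close> by simp
  next
    assume "None \<in> fraction_map a b ` extended_reals"
    from ratio[OF this] show "\<gamma> = 0" by (auto split: if_splits)
  qed
qed

section \<open>Non-injectivity on the curve\<close>

lemma noncritical_locally_injective:
  assumes "\<not> critical_point g (Some z)"
  obtains \<epsilon> where "\<epsilon> > 0" "\<And>x y. x \<in> ball z \<epsilon> \<Longrightarrow> y \<in> ball z \<epsilon> \<Longrightarrow> g (Some x) = g (Some y) \<Longrightarrow> x = y"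
proof -
  obtain U where U: "openin sphere_topology U" "Some z \<in> U" "inj_on g U"
    using assms by (auto simp: critical_point_def)
  obtain V where V: "open V" "Some -` U = V"
  proof -
    from U(1) consider V where "open V" "U = Some ` V"
      | C where "closed C" "U = insert None (Some ` (UNIV - C))"
      by (auto simp: openin_Alexandroff_compactification)
    then show thesis
    proof cases
      case 1
      then show thesis by (intro that[of V]) auto
    next
      case 2
      then show thesis by (intro that[of "- C"]) auto
    qed
  qed
  have "z \<in> V" using U(2) V(2) by auto
  then obtain \<epsilon> where "\<epsilon> > 0" "ball z \<epsilon> \<subseteq> V" using V(1) by (meson openE)
  show thesis
  proof
    show "\<epsilon> > 0" by fact
    fix x y assume "x \<in> ball z \<epsilon>" "y \<in> ball z \<epsilon>" "g (Some x) = g (Some y)"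
    then show "x = y" using \<open>ball z \<epsilon> \<subseteq> V\<close> V(2) inj_onD[OF U(3), of "Some x" "Some y"] by blast
  qed
qed

theorem theorem1p4:
  fixes f g :: "riemann_sphere \<Rightarrow> riemann_sphere" and \<Gamma> :: "riemann_sphere set"
  assumes "f \<in> rational_functions UNIV" and "\<not> f constant_on UNIV"
    and "g \<in> rational_functions UNIV" and "\<not> g constant_on UNIV"
    and "f \<circ> g \<in> rational_functions \<real>"
    and "weakly_injective g"
    and "\<Gamma> = g ` extended_reals"
    and "\<not> (\<exists>C. is_circle C \<and> \<Gamma> \<subseteq> C)"
  shows "\<not> inj_on (g \<circ> f) \<Gamma>"
proof
  assume "inj_on (g \<circ> f) \<Gamma>"
  then have inj_f: "inj_on f \<Gamma>" by (rule inj_on_imageI2)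
  obtain k l where f: "f = fraction_map k l" and kl: "coprime k l" "l \<noteq> 0"
    using assms(1) by (auto simp: rational_functions_def)
  obtain a b where g: "g = fraction_map a b" and ab: "coprime a b" "b \<noteq> 0"
    using assms(3) by (auto simp: rational_functions_def)
  obtain p q where h: "f \<circ> g = fraction_map p q" and pq: "coprime p q" "q \<noteq> 0"
    and real_coeffs: "\<And>i. coeff p i \<in> \<real>" "\<And>i. coeff q i \<in> \<real>"
    using assms(5) by (auto simp: rational_functions_def)
  have comp: "f (g z) = fraction_map p q z" for z using fun_cong[OF h] by simp
  have pos_kl: "0 < max (degree k) (degree l)"
    using nonconstant_fraction_map[OF kl(2)] assms(2) f by blast
  have pos_ab: "0 < max (degree a) (degree b)"
    using nonconstant_fraction_map[OF ab(2)] assms(4) g by blast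
  have fin_f: "finite {v. f v = y}" for y unfolding f by (rule finite_fibre_fraction_map[OF kl pos_kl])
  have fin_g: "finite {v. g v = y}" for y unfolding g by (rule finite_fibre_fraction_map[OF ab pos_ab])
  have "\<not> fraction_map p q constant_on UNIV"
  proof
    assume "fraction_map p q constant_on UNIV"
    then obtain y where "\<And>z. f (g z) = y" using comp by (auto simp: constant_on_def)
    then have "(UNIV :: riemann_sphere set) = (\<Union>v\<in>{v. f v = y}. {x. g x = v})" by auto
    also have "finite \<dots>" using fin_f fin_g by blast
    finally show False by (simp add: finite_option_UNIV infinite_UNIV_char_0)
  qed
  then have pos_pq: "0 < max (degree p) (degree q)" using nonconstant_fraction_map[OF pq(2)] by blast
  have fin_h: "finite {v. fraction_map p q v = y}" for y
    by (rule finite_fibre_fraction_map[OF pq pos_pq])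

  have h_inj: "g u = g v" if "u \<in> extended_reals" "v \<in> extended_reals"
      "fraction_map p q u = fraction_map p q v" for u v
    using inj_onD[OF inj_f, of "g u" "g v"] that assms(7) comp by auto
  have real_ext: "Some (complex_of_real x) \<in> extended_reals" for x
    by (simp add: extended_reals_def)
  obtain x0 :: real where noncrit: "\<not> critical_point g (Some x0)"
    and alone: "\<And>y. y \<in> extended_reals \<Longrightarrow> y \<noteq> Some x0 \<Longrightarrow> g y \<noteq> g (Some x0)"
    using assms(6) unfolding weakly_injective_def by (auto elim!: Reals_cases)
  obtain \<epsilon> where \<epsilon>: "\<epsilon> > 0" "\<And>x y. x \<in> ball (complex_of_real x0) \<epsilon> \<Longrightarrow>
      y \<in> ball (complex_of_real x0) \<epsilon> \<Longrightarrow> g (Some x) = g (Some y) \<Longrightarrow> x = y"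
    using noncritical_locally_injective[OF noncrit] by metis
  have ball_real: "complex_of_real x \<in> ball (of_real x0) \<epsilon> \<longleftrightarrow> \<bar>x - x0\<bar> < \<epsilon>" for x
    by (metis abs_minus_commute dist_of_real dist_real_def mem_ball)
  have "\<exists>e>0. \<forall>x y :: real. \<bar>x - x0\<bar> < e \<longrightarrow>
      fraction_map p q (Some y) = fraction_map p q (Some x) \<longrightarrow> y = x"
  proof (rule single_real_fibres[OF pq \<epsilon>(1), of x0])
    show "x = y" if "\<bar>x - x0\<bar> < \<epsilon>" "\<bar>y - x0\<bar> < \<epsilon>"
      "fraction_map p q (Some x) = fraction_map p q (Some y)" for x y :: real
    proof -
      have "g (Some x) = g (Some y)" by (rule h_inj[OF real_ext real_ext that(3)])
      then have "complex_of_real x = of_real y" by (rule \<epsilon>(2)[rotated 2]) (use that ball_real in blast)+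
      then show ?thesis by simp
    qed
    show "fraction_map p q (Some y) \<noteq> fraction_map p q (Some x0)" if "y \<noteq> x0" for y :: real
    proof
      assume "fraction_map p q (Some y) = fraction_map p q (Some x0)"
      then have "g (Some y) = g (Some x0)" by (rule h_inj[OF real_ext real_ext])
      then show False using alone[OF real_ext[of y]] that by simp
    qed
    show "fraction_map p q None \<noteq> fraction_map p q (Some x0)"
    proof
      have None: "None \<in> extended_reals" by (simp add: extended_reals_def)
      assume "fraction_map p q None = fraction_map p q (Some x0)"
      then have "g None = g (Some x0)" by (rule h_inj[OF None real_ext])
      then show False using alone[OF None] by simp
    qed
  qed
  then obtain e where e: "e > 0" "\<And>x y :: real. \<bar>x - x0\<bar> < e \<Longrightarrow>
      fraction_map p q (Some y) = fraction_map p q (Some x) \<Longrightarrow> y = x"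
    by blast

  define T where "T = good_values k l p q"
  \<comment> \<open>A point outside \<open>bad\<close> has finite images under \<open>f \<circ> g\<close> and \<open>g\<close>, both regular.\<close>
  define bad where "bad = {x :: real. fraction_map p q (Some x) \<in> insert None (Some ` (- T)) \<or>
    g (Some x) \<in> insert None (Some ` {w. \<not> regular_value a b w})}"
  have "finite bad"
  proof -
    have "finite (\<Union>y\<in>insert None (Some ` (- T)). {v. fraction_map p q v = y})"
      using fin_h finite_compl_good_values[OF kl(1) pos_kl pq(1) pos_pq] by (simp add: T_def)
    moreover have "finite (\<Union>y\<in>insert None (Some ` {w. \<not> regular_value a b w}). {v. g v = y})"
      using fin_g finite_irregular_values[OF ab(1) pos_ab] by simp
    ultimately have "finite ((\<lambda>x. Some (complex_of_real x)) -`
        ((\<Union>y\<in>insert None (Some ` (- T)). {v. fraction_map p q v = y}) \<union>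
        (\<Union>y\<in>insert None (Some ` {w. \<not> regular_value a b w}). {v. g v = y})))"
      by (intro finite_vimageI) (auto simp: inj_def)
    then show ?thesis by (rule finite_subset[rotated]) (auto simp: bad_def)
  qed
  define G where "G = {x0 - e <..< x0 + e} - bad"
  have "infinite G" using e(1) \<open>finite bad\<close> by (simp add: G_def)
  have pencil: "poly b x \<noteq> 0 \<and> (\<exists>c. smult (cnj (poly b x)) (map_poly cnj a) - smult (cnj (poly a x)) (map_poly cnj b) =
      smult c (smult (poly b x) a - smult (poly a x) b))" if "x \<in> G" for x :: real
  proof -
    have "\<bar>x - x0\<bar> < e" "x \<notin> bad" using that by (auto simp: G_def)
    then obtain t w where tw: "fraction_map p q (Some x) = Some t" "t \<in> T"
        "g (Some x) = Some w" "regular_value a b w"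
      by (cases "fraction_map p q (Some x)"; cases "g (Some x)") (auto simp: bad_def)
    have hx: "poly q x \<noteq> 0" "plane_map p q x \<in> good_values k l p q"
      using tw(1,2) fraction_map_Some_iff by (auto simp: T_def)
    have gx: "poly b x \<noteq> 0" "regular_value a b (plane_map a b x)"
      using tw(3,4) fraction_map_Some_iff g by auto
    have "poly b (cnj z) \<noteq> 0 \<and> plane_map a b (cnj z) = plane_map a b x"
      if "fraction_map a b (Some z) = fraction_map a b (Some x)" for z
      using conjugate_point_same_value[OF kl pos_kl ab(1) pq pos_pq comp[unfolded f g] real_coeffs hx
          e(2)[OF \<open>\<bar>x - x0\<bar> < e\<close>] that] by blast
    then show ?thesis using gx conjugate_pencil[OF ab(1) pos_ab gx] by metis
  qed
  \<comment> \<open>The two pencils are independent only if the two values of \<open>g\<close> differ.\<close>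
  obtain x1 where x1: "x1 \<in> G" using \<open>infinite G\<close> by (metis finite.emptyI ex_in_conv)
  have "finite ((\<lambda>x. Some (complex_of_real x)) -` {v. g v = g (Some x1)})"
    by (rule finite_vimageI[OF fin_g]) (auto simp: inj_def)
  then have "\<not> G \<subseteq> (\<lambda>x. Some (complex_of_real x)) -` {v. g v = g (Some x1)}"
    using \<open>infinite G\<close> finite_subset by blast
  then obtain x2 where x2: "x2 \<in> G" "g (Some x2) \<noteq> g (Some x1)" by blast
  have bx: "poly b x1 \<noteq> 0" "poly b x2 \<noteq> 0" using pencil x1 x2(1) by auto
  then have gx: "g (Some x1) = Some (plane_map a b x1)" "g (Some x2) = Some (plane_map a b x2)"
    unfolding g by (simp_all add: fraction_map_Some_iff)
  then have neq: "plane_map a b x1 \<noteq> plane_map a b x2" using x2(2) by auto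
  obtain c1 c2 where
    "smult (cnj (poly b x1)) (map_poly cnj a) - smult (cnj (poly a x1)) (map_poly cnj b) =
      smult c1 (smult (poly b x1) a - smult (poly a x1) b)"
    "smult (cnj (poly b x2)) (map_poly cnj a) - smult (cnj (poly a x2)) (map_poly cnj b) =
      smult c2 (smult (poly b x2) a - smult (poly a x2) b)"
    using pencil[OF x1] pencil[OF x2(1)] by blast
  then obtain \<alpha> \<beta> \<gamma> \<delta> where moebius: "\<gamma> \<noteq> 0 \<or> \<delta> \<noteq> 0"
    "map_poly cnj a = smult \<alpha> a + smult \<beta> b" "map_poly cnj b = smult \<gamma> a + smult \<delta> b"
    using conjugate_is_Moebius[OF bx neq] by metis
  have "\<exists>C. is_circle C \<and> fraction_map a b ` extended_reals \<subseteq> C"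
  proof (rule image_in_circle[OF ab moebius])
    show "Some (plane_map a b x1) \<in> fraction_map a b ` extended_reals"
      "Some (plane_map a b x2) \<in> fraction_map a b ` extended_reals"
      using gx g real_ext by (metis image_eqI)+
    show "plane_map a b x1 \<noteq> plane_map a b x2" by (rule neq)
  qed
  then show False using assms(7,8) g by simp
qed

end
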